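(* Let $m,l$ be positive coprime integers, and let $u=u(n,t)$, $f=f(n,t)$. Define \[ P=uT^{m+l}+T^l,\qquad Q=T^m+u, \] \[ A=f(T^{m}-T^{-m}),\qquad B=f_mT^m-f_lT^{-m}+u(f-f_{m+l}). \] Then the system \[ u_mf_m=uf_{m+l},\qquad u_{,t}=u^2(f-f_{m+l})+f_m-f_l \] possesses the Lax representation \[ L_{,t}=[A,L],\qquad L=Q^{-1}P, \] written in the form of the system \[ P_{,t}=BP-PA,\qquad Q_{,t}=BQ-QA ; \] that is, the pair of operator identities $P_{,t}=BP-PA$, $Q_{,t}=BQ-QA$ is equivalent to the pair of equations $u_mf_m=uf_{m+l}$, $u_{,t}=u^2(f-f_{m+l})+f_m-f_l$ for $u$ and $f$.
   Context: Here $u,f$ are functions of $n\in\mathbb Z$ and $t$; $u_{,t}=\partial_t u$, $u_j=u(n+j,t)$, $f_j=f(n+j,t)$. $T$ is the shift operator $n\mapsto n+1$. Difference operators are Laurent polynomials in $T$ with coefficients depending on the shifts of $u$ and $f$, multiplied by the rule $T\,a=T(a)\,T$. The $t$-derivative of an operator is taken coefficientwise. $Q^{-1}$ is understood as a formal series in decreasing powers of $T$, and $[A,L]=AL-LA$. The variable $f$ is in general nonlocal: it is not required to be a function of finitely many $u_j$ and is only constrained by the equation $u_mf_m=uf_{m+l}$. The system is the simplest one in the so-called extended dSK$^{(l,m)}$ hierarchy, associated with the spectral problem $P\psi=\lambda Q\psi$. *)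

theory Defs
  imports "HOL-Analysis.Analysis" "HOL-Library.Groups_Big_Fun"
begin

text \<open>
  An element \<open>X\<close> stands for the formal series \<open>\<Sum>k\<le>N. X k \<cdot> T\<^sup>k\<close>, where each coefficient
  \<open>X k\<close> is a function of \<open>n \<in> \<int>\<close>, written to the left of the power of \<open>T\<close>.  Laurent polynomials
  in \<open>T\<close> are the elements with finitely many nonzero coefficients.
\<close>

typedef (overloaded) ('a::zero) shift_series =
  "{X :: int \<Rightarrow> int \<Rightarrow> 'a. \<exists>N. \<forall>k>N. X k = (\<lambda>n. 0)}"
  morphisms coeff Abs_shift_series
  by (rule exI[of _ "\<lambda>k n. 0"]) simp

setup_lifting type_definition_shift_series

lemma shift_series_eqI: "(\<And>k n. coeff X k n = coeff Y k n) \<Longrightarrow> X = Y"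
  by (simp add: coeff_inject[symmetric] fun_eq_iff)

lemma coeff_bounded: "\<exists>N. \<forall>k>N. \<forall>n. coeff X k n = 0"
  by transfer (auto simp: fun_eq_iff)

instantiation shift_series :: (ab_group_add) ab_group_add
begin

lift_definition zero_shift_series :: "'a shift_series" is "\<lambda>k n. 0"
  by simp

lift_definition plus_shift_series :: "'a shift_series \<Rightarrow> 'a shift_series \<Rightarrow> 'a shift_series"
  is "\<lambda>X Y k n. X k n + Y k n"
proof -
  fix X Y :: "int \<Rightarrow> int \<Rightarrow> 'a"
  assume "\<exists>N. \<forall>k>N. X k = (\<lambda>n. 0)" "\<exists>N. \<forall>k>N. Y k = (\<lambda>n. 0)"
  then obtain M N where "\<forall>k>M. X k = (\<lambda>n. 0)" "\<forall>k>N. Y k = (\<lambda>n. 0)" by blast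
  then show "\<exists>N. \<forall>k>N. (\<lambda>n. X k n + Y k n) = (\<lambda>n. 0)"
    by (intro exI[of _ "max M N"]) simp
qed

lift_definition uminus_shift_series :: "'a shift_series \<Rightarrow> 'a shift_series"
  is "\<lambda>X k n. - X k n"
  by (force simp: fun_eq_iff)

definition minus_shift_series :: "'a shift_series \<Rightarrow> 'a shift_series \<Rightarrow> 'a shift_series"
  where "minus_shift_series X Y = X + (- Y)"

lemma coeff_zero [simp]: "coeff 0 k n = 0"
  by transfer simp

lemma coeff_plus [simp]: "coeff (X + Y) k n = coeff X k n + coeff Y k n"
  by transfer simp

lemma coeff_uminus [simp]: "coeff (- X) k n = - coeff X k n"
  by transfer simp

lemma coeff_minus [simp]: "coeff (X - Y) k n = coeff X k n - coeff Y k n"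
  by (simp add: minus_shift_series_def)

instance
  by standard (auto intro!: shift_series_eqI simp: ac_simps)

end

lemma Sum_any_eq_sum_interval:
  fixes X Y :: "int \<Rightarrow> int \<Rightarrow> 'a::ring_1"
  assumes "\<And>i n. N < i \<Longrightarrow> X i n = 0" "\<And>i n. M < i \<Longrightarrow> Y i n = 0"
    and "a \<le> k - M" "N \<le> b"
  shows "Sum_any (\<lambda>i. X i n * Y (k - i) (n + i)) = (\<Sum>i=a..b. X i n * Y (k - i) (n + i))"
proof (rule Sum_any.expand_superset)
  show "{i. X i n * Y (k - i) (n + i) \<noteq> 0} \<subseteq> {a..b}"
  proof
    fix i assume "i \<in> {i. X i n * Y (k - i) (n + i) \<noteq> 0}"
    then have "X i n \<noteq> 0" "Y (k - i) (n + i) \<noteq> 0" by auto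
    then have "\<not> N < i" "\<not> M < k - i" using assms(1,2) by blast+
    then show "i \<in> {a..b}" using assms(3,4) by auto
  qed
qed simp

instantiation shift_series :: (ring_1) ring_1
begin

lift_definition one_shift_series :: "'a shift_series" is "\<lambda>k n. if k = 0 then 1 else 0"
  by (rule exI[of _ 0]) simp

text \<open>
  The rule \<open>T a = T(a) T\<close> gives \<open>(a T\<^sup>i) (b T\<^sup>j) = a T\<^sup>i(b) T\<^sup>i\<^sup>+\<^sup>j\<close>.  The sum below has finite support.
\<close>

lift_definition times_shift_series :: "'a shift_series \<Rightarrow> 'a shift_series \<Rightarrow> 'a shift_series"
  is "\<lambda>X Y k n. Sum_any (\<lambda>i. X i n * Y (k - i) (n + i))"
proof -
  fix X Y :: "int \<Rightarrow> int \<Rightarrow> 'a"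
  assume "\<exists>N. \<forall>k>N. X k = (\<lambda>n. 0)" "\<exists>N. \<forall>k>N. Y k = (\<lambda>n. 0)"
  then obtain N M where *: "\<forall>k>N. X k = (\<lambda>n. 0)" "\<forall>k>M. Y k = (\<lambda>n. 0)" by blast
  show "\<exists>N. \<forall>k>N. (\<lambda>n. Sum_any (\<lambda>i. X i n * Y (k - i) (n + i))) = (\<lambda>n. 0)"
  proof (intro exI[of _ "N + M"] allI impI ext)
    fix k n assume "N + M < k"
    moreover have "Sum_any (\<lambda>i. X i n * Y (k - i) (n + i)) =
        (\<Sum>i=k-M..N. X i n * Y (k - i) (n + i))"
      by (rule Sum_any_eq_sum_interval[where N = N and M = M]) (use * in auto)
    ultimately show "Sum_any (\<lambda>i. X i n * Y (k - i) (n + i)) = 0" by simp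
  qed
qed

lemma coeff_one: "coeff 1 k n = (if k = 0 then 1 else 0)"
  by transfer simp

lemma coeff_times: "coeff (X * Y) k n = Sum_any (\<lambda>i. coeff X i n * coeff Y (k - i) (n + i))"
  by transfer simp

lemma coeff_times_interval:
  assumes "\<forall>i>N. \<forall>n. coeff X i n = 0" "\<forall>i>M. \<forall>n. coeff Y i n = 0" "a \<le> k - M" "N \<le> b"
  shows "coeff (X * Y) k n = (\<Sum>i=a..b. coeff X i n * coeff Y (k - i) (n + i))"
  unfolding coeff_times
  by (rule Sum_any_eq_sum_interval[where N = N and M = M]) (use assms in auto)

lemma coeff_times_bounded:
  assumes "\<forall>i>N. \<forall>n. coeff X i n = 0" "\<forall>i>M. \<forall>n. coeff Y i n = 0"
  shows "\<forall>i>N + M. \<forall>n. coeff (X * Y) i n = 0"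
  using coeff_times_interval[OF assms order_refl order_refl] by simp

instance
proof
  fix X Y Z :: "'a shift_series"
  obtain N where N: "\<forall>k>N. \<forall>n. coeff X k n = 0" using coeff_bounded by blast
  obtain M where M: "\<forall>k>M. \<forall>n. coeff Y k n = 0" using coeff_bounded by blast
  obtain K where K: "\<forall>k>K. \<forall>n. coeff Z k n = 0" using coeff_bounded by blast
  show "X * Y * Z = X * (Y * Z)"
  proof (rule shift_series_eqI)
    fix k n
    define S where "S = {k-K-M..N}"
    define R where "R = {k-K..N+M}"
    have "coeff (X * Y * Z) k n = (\<Sum>j\<in>R. coeff (X * Y) j n * coeff Z (k - j) (n + j))"
      unfolding R_def
      by (rule coeff_times_interval[OF coeff_times_bounded[OF N M] K]) auto
    also have "\<dots> = (\<Sum>j\<in>R. (\<Sum>i\<in>S. coeff X i n * coeff Y (j - i) (n + i)) *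
        coeff Z (k - j) (n + j))"
    proof (rule sum.cong[OF refl])
      fix j assume "j \<in> R"
      then have "coeff (X * Y) j n = (\<Sum>i\<in>S. coeff X i n * coeff Y (j - i) (n + i))"
        unfolding S_def R_def by (intro coeff_times_interval[OF N M]) auto
      then show "coeff (X * Y) j n * coeff Z (k - j) (n + j) =
        (\<Sum>i\<in>S. coeff X i n * coeff Y (j - i) (n + i)) * coeff Z (k - j) (n + j)" by simp
    qed
    also have "\<dots> = (\<Sum>i\<in>S. \<Sum>j\<in>R. coeff X i n *
        (coeff Y (j - i) (n + i) * coeff Z (k - j) (n + j)))"
      unfolding sum_distrib_right by (subst sum.swap) (simp add: mult.assoc)
    also have "\<dots> = (\<Sum>i\<in>S. coeff X i n * coeff (Y * Z) (k - i) (n + i))"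
    proof (rule sum.cong[OF refl])
      fix i assume i: "i \<in> S"
      have "coeff (Y * Z) (k - i) (n + i) =
          (\<Sum>j=k-K-i..N+M-i. coeff Y j (n + i) * coeff Z (k - i - j) (n + i + j))"
        using i unfolding S_def by (intro coeff_times_interval[OF M K]) auto
      also have "\<dots> = (\<Sum>j\<in>R. coeff Y (j - i) (n + i) * coeff Z (k - j) (n + j))"
        unfolding R_def
        by (rule sum.reindex_bij_witness[of _ "\<lambda>j. j - i" "\<lambda>j. j + i"])
           (auto simp: algebra_simps)
      finally show "(\<Sum>j\<in>R. coeff X i n * (coeff Y (j - i) (n + i) * coeff Z (k - j) (n + j))) =
          coeff X i n * coeff (Y * Z) (k - i) (n + i)"
        by (simp add: sum_distrib_left)
    qed
    also have "\<dots> = coeff (X * (Y * Z)) k n"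
      unfolding S_def
      by (rule coeff_times_interval[OF N coeff_times_bounded[OF M K], symmetric]) auto
    finally show "coeff (X * Y * Z) k n = coeff (X * (Y * Z)) k n" .
  qed
  have one: "\<forall>k>0. \<forall>n. coeff (1 :: 'a shift_series) k n = 0"
    by (simp add: coeff_one)
  show "1 * X = X"
  proof (rule shift_series_eqI)
    fix k n
    have "coeff (1 * X) k n = (\<Sum>i=min 0 (k-N)..0. coeff 1 i n * coeff X (k - i) (n + i))"
      by (rule coeff_times_interval[OF one N]) auto
    also have "\<dots> = (\<Sum>i\<in>{0}. coeff 1 i n * coeff X (k - i) (n + i))"
      by (rule sum.mono_neutral_right) (auto simp: coeff_one)
    finally show "coeff (1 * X) k n = coeff X k n" by (simp add: coeff_one)
  qed
  show "X * 1 = X"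
  proof (rule shift_series_eqI)
    fix k n
    have "coeff (X * 1) k n = (\<Sum>i=k..max k N. coeff X i n * coeff 1 (k - i) (n + i))"
      by (rule coeff_times_interval[OF N one]) auto
    also have "\<dots> = (\<Sum>i\<in>{k}. coeff X i n * coeff 1 (k - i) (n + i))"
      by (rule sum.mono_neutral_right) (auto simp: coeff_one)
    finally show "coeff (X * 1) k n = coeff X k n" by (simp add: coeff_one)
  qed
  show "(X + Y) * Z = X * Z + Y * Z"
  proof (rule shift_series_eqI)
    fix k n
    let ?b = "max N M"
    have XY: "\<forall>i>?b. \<forall>n. coeff (X + Y) i n = 0" using N M by simp
    have "coeff ((X + Y) * Z) k n = (\<Sum>i=k-K..?b. coeff (X + Y) i n * coeff Z (k - i) (n + i))"
      by (rule coeff_times_interval[OF XY K]) auto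
    moreover have "coeff (X * Z) k n = (\<Sum>i=k-K..?b. coeff X i n * coeff Z (k - i) (n + i))"
      by (rule coeff_times_interval[OF N K]) auto
    moreover have "coeff (Y * Z) k n = (\<Sum>i=k-K..?b. coeff Y i n * coeff Z (k - i) (n + i))"
      by (rule coeff_times_interval[OF M K]) auto
    ultimately show "coeff ((X + Y) * Z) k n = coeff (X * Z + Y * Z) k n"
      by (simp add: distrib_right sum.distrib)
  qed
  show "X * (Y + Z) = X * Y + X * Z"
  proof (rule shift_series_eqI)
    fix k n
    let ?b = "max M K"
    have YZ: "\<forall>i>?b. \<forall>n. coeff (Y + Z) i n = 0" using M K by simp
    have "coeff (X * (Y + Z)) k n = (\<Sum>i=k-?b..N. coeff X i n * coeff (Y + Z) (k - i) (n + i))"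
      by (rule coeff_times_interval[OF N YZ]) auto
    moreover have "coeff (X * Y) k n = (\<Sum>i=k-?b..N. coeff X i n * coeff Y (k - i) (n + i))"
      by (rule coeff_times_interval[OF N M]) auto
    moreover have "coeff (X * Z) k n = (\<Sum>i=k-?b..N. coeff X i n * coeff Z (k - i) (n + i))"
      by (rule coeff_times_interval[OF N K]) auto
    ultimately show "coeff (X * (Y + Z)) k n = coeff (X * Y + X * Z) k n"
      by (simp add: distrib_left sum.distrib)
  qed
  show "(0 :: 'a shift_series) \<noteq> 1"
  proof
    assume "(0 :: 'a shift_series) = 1"
    then have "coeff (0 :: 'a shift_series) 0 0 = coeff 1 0 0" by simp
    then show False by (simp add: coeff_one)
  qed
qed

end

lift_definition coef_op :: "(int \<Rightarrow> 'a::zero) \<Rightarrow> 'a shift_series"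
  is "\<lambda>a k n. if k = 0 then a n else 0"
  by (rule exI[of _ 0]) simp

lift_definition Tpow :: "int \<Rightarrow> 'a::zero_neq_one shift_series"
  is "\<lambda>j k n. if k = j then 1 else 0"
  subgoal for j by (rule exI[of _ j]) simp
  done

lemma coeff_coef_op: "coeff (coef_op a) k n = (if k = 0 then a n else 0)"
  by transfer simp

lemma coeff_Tpow: "coeff (Tpow j) k n = (if k = j then 1 else 0)"
  by transfer simp

lemma Sum_any_single:
  assumes "\<And>i. i \<noteq> j \<Longrightarrow> g i = 0"
  shows "Sum_any g = g j"
proof -
  have "Sum_any g = sum g {j}"
    by (rule Sum_any.expand_superset) (use assms in auto)
  then show ?thesis by simp
qed

lemma coeff_coef_op_times: "coeff (coef_op a * X) k n = a n * coeff X k n"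
  unfolding coeff_times by (subst Sum_any_single[where j = 0]) (auto simp: coeff_coef_op)

lemma coeff_Tpow_times: "coeff (Tpow j * X) k n = coeff X (k - j) (n + j)"
  unfolding coeff_times by (subst Sum_any_single[where j = j]) (auto simp: coeff_Tpow)

lemma coeff_times_coef_op: "coeff (X * coef_op a) k n = coeff X k n * a (n + k)"
  unfolding coeff_times by (subst Sum_any_single[where j = k]) (auto simp: coeff_coef_op)

lemma coeff_times_Tpow: "coeff (X * Tpow j) k n = coeff X (k - j) n"
  unfolding coeff_times by (subst Sum_any_single[where j = "k - j"]) (auto simp: coeff_Tpow)

lemma Tpow_0: "Tpow 0 = 1"
  by (rule shift_series_eqI) (simp add: coeff_Tpow coeff_one)

lemma Tpow_add: "Tpow (i + j) = Tpow i * Tpow j"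
  by (rule shift_series_eqI) (auto simp: coeff_Tpow_times coeff_Tpow)

lemma Tpow_coef_op: "Tpow j * coef_op a = coef_op (\<lambda>n. a (n + j)) * Tpow j"
  by (rule shift_series_eqI)
     (auto simp: coeff_Tpow_times coeff_coef_op_times coeff_coef_op coeff_Tpow)

definition series_inverse :: "'a::ring_1 shift_series \<Rightarrow> 'a shift_series"
  where "series_inverse X = (THE Y. X * Y = 1 \<and> Y * X = 1)"

lemma series_inverse_eqI:
  assumes "X * Y = 1" "Y * X = 1"
  shows "series_inverse X = Y"
  unfolding series_inverse_def
proof (rule the_equality)
  show "X * Y = 1 \<and> Y * X = 1" using assms by simp
  fix Z assume "X * Z = 1 \<and> Z * X = 1"
  then have "Z = Z * (X * Y)" "Z * X * Y = Y" using assms by auto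
  then show "Z = Y" by (simp add: mult.assoc)
qed

text \<open>
  The derivative of a time-dependent operator, taken coefficientwise; it includes the
  differentiability of all the coefficients at the given time.
\<close>

definition has_op_derivative ::
  "(real \<Rightarrow> 'a::real_normed_field shift_series) \<Rightarrow> 'a shift_series \<Rightarrow> real \<Rightarrow> bool"
  where "has_op_derivative X D t \<longleftrightarrow>
    (\<forall>k n. ((\<lambda>s. coeff (X s) k n) has_vector_derivative coeff D k n) (at t))"

definition lax_P :: "int \<Rightarrow> int \<Rightarrow> (int \<Rightarrow> real \<Rightarrow> 'a::real_normed_field) \<Rightarrow> real \<Rightarrow> 'a shift_series"
  where "lax_P m l u t = coef_op (\<lambda>n. u n t) * Tpow (m + l) + Tpow l"

definition lax_Q :: "int \<Rightarrow> (int \<Rightarrow> real \<Rightarrow> 'a::real_normed_field) \<Rightarrow> real \<Rightarrow> 'a shift_series"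
  where "lax_Q m u t = Tpow m + coef_op (\<lambda>n. u n t)"

definition lax_A :: "int \<Rightarrow> (int \<Rightarrow> real \<Rightarrow> 'a::real_normed_field) \<Rightarrow> real \<Rightarrow> 'a shift_series"
  where "lax_A m f t = coef_op (\<lambda>n. f n t) * (Tpow m - Tpow (- m))"

definition lax_B :: "int \<Rightarrow> int \<Rightarrow> (int \<Rightarrow> real \<Rightarrow> 'a::real_normed_field) \<Rightarrow>
    (int \<Rightarrow> real \<Rightarrow> 'a) \<Rightarrow> real \<Rightarrow> 'a shift_series"
  where "lax_B m l u f t =
    coef_op (\<lambda>n. f (n + m) t) * Tpow m - coef_op (\<lambda>n. f (n + l) t) * Tpow (- m)
      + coef_op (\<lambda>n. u n t * (f n t - f (n + m + l) t))"

definition lax_L :: "int \<Rightarrow> int \<Rightarrow> (int \<Rightarrow> real \<Rightarrow> 'a::real_normed_field) \<Rightarrow> real \<Rightarrow> 'a shift_series"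
  where "lax_L m l u t = series_inverse (lax_Q m u t) * lax_P m l u t"

text \<open>
  For \<open>m > 0\<close> the operator \<open>Q\<close> is invertible whatever \<open>u\<close> is, so that \<open>lax_L\<close> involves a genuine
  two-sided inverse: \<open>Q\<^sup>-\<^sup>1 = T\<^sup>-\<^sup>m - T\<^sup>-\<^sup>m u T\<^sup>-\<^sup>m + \<dots>\<close>.
\<close>

lift_definition lax_Q_inv :: "int \<Rightarrow> (int \<Rightarrow> 'a::comm_ring_1) \<Rightarrow> 'a shift_series"
  is "\<lambda>m v k n. if 0 < m \<and> m dvd k \<and> k < 0
        then (\<Prod>i=1..<nat (- k div m). - v (n - int i * m)) else 0"
  by (rule exI[of _ 0]) (simp add: fun_eq_iff)

lemma coeff_lax_Q_inv:
  assumes "0 < m"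
  shows "coeff (lax_Q_inv m v) k n = (if m dvd k \<and> k < 0
    then (\<Prod>i=1..<nat (- k div m). - v (n - int i * m)) else 0)"
  using assms by transfer simp

lemma lax_Q_times_inv:
  fixes u :: "int \<Rightarrow> real \<Rightarrow> 'a::real_normed_field"
  assumes m: "0 < m"
  shows "lax_Q m u t * lax_Q_inv m (\<lambda>n. u n t) = 1"
    and "lax_Q_inv m (\<lambda>n. u n t) * lax_Q m u t = 1"
proof -
  let ?R = "lax_Q_inv m (\<lambda>n. u n t)"
  have not_dvd: "coeff ?R k n = 0" if "\<not> m dvd k" for k n
    using that m by (simp add: coeff_lax_Q_inv)
  have nonneg: "coeff ?R (m * q) n = 0" if "q \<ge> 0" for q n
    using that m by (simp add: coeff_lax_Q_inv mult_less_0_iff)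
  have neg: "coeff ?R (m * (- 1 - int j)) n = (\<Prod>i=1..j. - u (n - int i * m) t)" for j n
  proof -
    have "- (m * (- 1 - int j)) div m = 1 + int j"
      using m by (simp add: minus_mult_right del: mult_minus_right)
    moreover have "{1..<Suc j} = {1..j}" by auto
    moreover have "m * (- 1 - int j) < 0" using m by (simp add: mult_less_0_iff)
    ultimately show ?thesis using m
      by (simp add: coeff_lax_Q_inv nat_add_distrib)
  qed
  have cases: "(\<not> m dvd k) \<or> (\<exists>q>0. k = m * q) \<or> k = 0 \<or> (\<exists>j. k = m * (- 1 - int j))" for k
  proof (cases "m dvd k")
    case True
    then obtain q where q: "k = m * q" by blast
    show ?thesis
    proof (cases "q < 0")
      case True
      then have "q = - 1 - int (nat (- 1 - q))" by simp
      then show ?thesis using q by metis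
    next
      case False
      then show ?thesis using q by (cases "q = 0") auto
    qed
  qed simp
  have zero: "coeff ?R 0 n = 0" for n using nonneg[of 0] by simp
  have top: "coeff ?R (- m) n = 1" for n using neg[of 0] by simp
  have shift_pos: "m * q - m = m * (q - 1)" for q by (simp add: algebra_simps)
  have shift_neg: "m * (- 1 - int j) - m = m * (- 1 - int (Suc j))" for j
    by (simp add: algebra_simps)
  show "lax_Q m u t * ?R = 1"
  proof (rule shift_series_eqI)
    fix k n
    have *: "coeff (lax_Q m u t * ?R) k n = coeff ?R (k - m) (n + m) + u n t * coeff ?R k n"
      by (simp add: lax_Q_def distrib_right coeff_Tpow_times coeff_coef_op_times)
    consider "\<not> m dvd k" | q where "q > 0" "k = m * q" | "k = 0" | j where "k = m * (- 1 - int j)"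
      using cases by blast
    then show "coeff (lax_Q m u t * ?R) k n = coeff 1 k n"
    proof cases
      case 1
      then have "\<not> m dvd k - m" "k \<noteq> 0" by (auto simp: dvd_diff_left_iff)
      then show ?thesis using 1 by (simp add: * not_dvd coeff_one)
    next
      case 2
      then have "k \<noteq> 0" using m by simp
      moreover have "coeff ?R (k - m) i = 0" "coeff ?R k i = 0" for i
        using nonneg[of q i] nonneg[of "q - 1" i] 2 by (simp_all only: shift_pos)
      ultimately show ?thesis by (simp only: *) (simp add: coeff_one)
    next
      case 3
      then show ?thesis unfolding * by (simp add: zero top coeff_one)
    next
      case 4
      have "(\<Prod>i=1..Suc j. - u (n + m - int i * m) t)
          = - u n t * (\<Prod>i=1..j. - u (n - int i * m) t)"
      proof -
        have "(\<Prod>i=1..Suc j. - u (n + m - int i * m) t)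
            = (\<Prod>i=0..j. - u (n - int i * m) t)"
          by (rule prod.reindex_bij_witness[of _ Suc "\<lambda>i. i - 1"])
             (auto simp: algebra_simps of_nat_diff)
        also have "\<dots> = - u n t * (\<Prod>i=1..j. - u (n - int i * m) t)"
          by (simp add: prod.atLeast_Suc_atMost)
        finally show ?thesis .
      qed
      moreover have "k \<noteq> 0" using 4 m by simp
      ultimately show ?thesis
        unfolding * unfolding 4 shift_neg neg by (simp add: coeff_one)
    qed
  qed
  show "?R * lax_Q m u t = 1"
  proof (rule shift_series_eqI)
    fix k n
    have *: "coeff (?R * lax_Q m u t) k n = coeff ?R (k - m) n + coeff ?R k n * u (n + k) t"
      by (simp add: lax_Q_def distrib_left coeff_times_Tpow coeff_times_coef_op)
    consider "\<not> m dvd k" | q where "q > 0" "k = m * q" | "k = 0" | j where "k = m * (- 1 - int j)"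
      using cases by blast
    then show "coeff (?R * lax_Q m u t) k n = coeff 1 k n"
    proof cases
      case 1
      then have "\<not> m dvd k - m" "k \<noteq> 0" by (auto simp: dvd_diff_left_iff)
      then show ?thesis using 1 by (simp add: * not_dvd coeff_one)
    next
      case 2
      then have "k \<noteq> 0" using m by simp
      moreover have "coeff ?R (k - m) i = 0" "coeff ?R k i = 0" for i
        using nonneg[of q i] nonneg[of "q - 1" i] 2 by (simp_all only: shift_pos)
      ultimately show ?thesis by (simp only: *) (simp add: coeff_one)
    next
      case 3
      then show ?thesis unfolding * by (simp add: zero top coeff_one)
    next
      case 4
      have "n + m * (- 1 - int j) = n - int (Suc j) * m" by (simp add: algebra_simps)
      moreover have "k \<noteq> 0" using 4 m by simp
      ultimately show ?thesis
        unfolding * unfolding 4 shift_neg neg by (simp add: coeff_one)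
    qed
  qed
qed

lemma series_inverse_lax_Q:
  assumes "0 < m"
  shows "lax_Q m u t * series_inverse (lax_Q m u t) = 1"
    and "series_inverse (lax_Q m u t) * lax_Q m u t = 1"
  using lax_Q_times_inv[OF assms, of u t] series_inverse_eqI by metis+

end

theory Submission
  imports Defs
begin

text \<open>
  Both pairs of equations are compared coefficientwise.  In \<open>P\<^sub>t = BP - PA\<close> the powers
  \<open>T\<^sup>2\<^sup>m\<^sup>+\<^sup>l\<close>, \<open>T\<^sup>l\<close> carry the constraint (at \<open>n\<close> and \<open>n - m\<close>) and \<open>T\<^sup>m\<^sup>+\<^sup>l\<close> the evolution
  equation; in \<open>Q\<^sub>t = BQ - QA\<close> the powers \<open>T\<^sup>m\<close>, \<open>T\<^sup>-\<^sup>m\<close> carry the constraint and \<open>T\<^sup>0\<close> the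
  evolution equation.  For the Lax equation, each coefficient of \<open>R = Q\<^sup>-\<^sup>1\<close> is a polynomial in
  shifts of \<open>u\<close>, hence \<open>R\<close> is differentiable, \<open>R\<^sub>t = - R Q\<^sub>t R\<close>, and
  \<open>L\<^sub>t = - R (BQ - QA) R P + R (BP - PA) = AL - LA\<close>.
\<close>

lemma coeff_lax_P:
  "coeff (lax_P m l u t) k n = (if k = m + l then u n t else 0) + (if k = l then 1 else 0)"
  by (simp add: lax_P_def coeff_coef_op_times coeff_Tpow)

lemma coeff_lax_Q:
  "coeff (lax_Q m u t) k n = (if k = m then 1 else 0) + (if k = 0 then u n t else 0)"
  by (simp add: lax_Q_def coeff_coef_op coeff_Tpow)

text \<open>Both products contribute \<open>- f (n + l) t\<close> at \<open>T^(l - m)\<close>, so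
  this power cancels. At \<open>T^l\<close> the zero-order term of \<open>B\<close> combines with
  the rest into the constraint at \<open>n - m\<close>.\<close>

lemma coeff_lax_P_rhs:
  assumes "0 < m" "0 < l"
  shows "coeff (lax_B m l u f t * lax_P m l u t - lax_P m l u t * lax_A m f t) k n =
    (if k = 2 * m + l then u (n + m) t * f (n + m) t - u n t * f (n + m + l) t
     else if k = m + l then (u n t)\<^sup>2 * (f n t - f (n + m + l) t) + f (n + m) t - f (n + l) t
     else if k = l then u n t * f n t - u (n - m) t * f (n + l) t
     else 0)"
  using assms
  \<comment> \<open>Operator products are bracketed to the right, so that the coefficient rules can
    peel off the leftmost factor.\<close>
  by (auto simp: lax_B_def lax_P_def lax_A_def algebra_simps power2_eq_square
      mult.assoc[where 'a = "'a shift_series"]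
      coeff_coef_op_times coeff_Tpow_times coeff_Tpow coeff_times_Tpow coeff_coef_op)

text \<open>Here the cancelling power is \<open>T^(2 * m)\<close>, with coefficient
  \<open>f (n + m) t\<close> in both products.\<close>

lemma coeff_lax_Q_rhs:
  assumes "0 < m"
  shows "coeff (lax_B m l u f t * lax_Q m u t - lax_Q m u t * lax_A m f t) k n =
    (if k = m then u (n + m) t * f (n + m) t - u n t * f (n + m + l) t
     else if k = 0 then (u n t)\<^sup>2 * (f n t - f (n + m + l) t) + f (n + m) t - f (n + l) t
     else if k = - m then u n t * f n t - u (n - m) t * f (n + l) t
     else 0)"
  using assms
  by (auto simp: lax_B_def lax_Q_def lax_A_def algebra_simps power2_eq_square
      mult.assoc[where 'a = "'a shift_series"]
      coeff_coef_op_times coeff_Tpow_times coeff_Tpow coeff_times_Tpow coeff_coef_op)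

lemma has_op_derivative_unique:
  assumes "has_op_derivative X D t" "has_op_derivative X E t"
  shows "D = E"
  using assms unfolding has_op_derivative_def
  by (blast intro: shift_series_eqI vector_derivative_unique_at)

lemma has_op_derivative_const: "has_op_derivative (\<lambda>s. X) 0 t"
  by (simp add: has_op_derivative_def)

text \<open>Above \<open>N\<close> the derivative is that of the constant 0. This lets the interval
  formula for products apply to derivatives too.\<close>

lemma has_op_derivative_bounded:
  assumes "has_op_derivative X D t" "\<And>s. \<forall>k>N. \<forall>n. coeff (X s) k n = 0"
  shows "\<forall>k>N. \<forall>n. coeff D k n = 0"
proof (intro allI impI)
  fix k n assume "N < k"
  then have "((\<lambda>s. 0) has_vector_derivative coeff D k n) (at t)"
    using assms(1)[unfolded has_op_derivative_def, rule_format, of k n] assms(2) by simp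
  then show "coeff D k n = 0"
    using has_vector_derivative_const vector_derivative_unique_at by blast
qed

text \<open>
  The bounds must be uniform in time: only then are the coefficients of the product finite sums
  over a fixed range.
\<close>

lemma has_op_derivative_times:
  assumes X: "has_op_derivative X D t" and Y: "has_op_derivative Y E t"
    and N: "\<And>s. \<forall>k>N. \<forall>n. coeff (X s) k n = 0"
    and M: "\<And>s. \<forall>k>M. \<forall>n. coeff (Y s) k n = 0"
  shows "has_op_derivative (\<lambda>s. X s * Y s) (D * Y t + X t * E) t"
  unfolding has_op_derivative_def
proof (intro allI)
  fix k n
  let ?S = "{k - M..N}"
  have "coeff (D * Y t + X t * E) k n =
      (\<Sum>i\<in>?S. coeff (X t) i n * coeff E (k - i) (n + i)
        + coeff D i n * coeff (Y t) (k - i) (n + i))"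
    using coeff_times_interval[OF has_op_derivative_bounded[OF X N] M order_refl order_refl]
      coeff_times_interval[OF N has_op_derivative_bounded[OF Y M] order_refl order_refl]
    by (simp add: sum.distrib add.commute)
  moreover have "((\<lambda>s. \<Sum>i\<in>?S. coeff (X s) i n * coeff (Y s) (k - i) (n + i))
      has_vector_derivative
      (\<Sum>i\<in>?S. coeff (X t) i n * coeff E (k - i) (n + i)
        + coeff D i n * coeff (Y t) (k - i) (n + i))) (at t)"
    using X Y unfolding has_op_derivative_def
    by (intro has_vector_derivative_sum has_vector_derivative_mult) auto
  moreover have "coeff (X s * Y s) k n =
      (\<Sum>i\<in>?S. coeff (X s) i n * coeff (Y s) (k - i) (n + i))" for s
    by (rule coeff_times_interval[OF N M order_refl order_refl])
  ultimately show "((\<lambda>s. coeff (X s * Y s) k n) has_vector_derivative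
      coeff (D * Y t + X t * E) k n) (at t)" by simp
qed

text \<open>The derivatives of the coefficients form a formal series because one \<open>N\<close>
  bounds the powers at all times.\<close>

lemma has_op_derivative_exists:
  fixes X :: "real \<Rightarrow> 'a::real_normed_field shift_series"
  assumes "\<And>k n. (\<lambda>s. coeff (X s) k n) differentiable (at t)"
    and "\<And>s. \<forall>k>N. \<forall>n. coeff (X s) k n = 0"
  obtains D where "has_op_derivative X D t"
proof
  define d where "d k n = vector_derivative (\<lambda>s. coeff (X s) k n) (at t)" for k n
  have "\<exists>N. \<forall>k>N. d k = (\<lambda>n. 0)"
    using assms(2) by (intro exI[of _ N]) (simp add: d_def fun_eq_iff)
  then have "coeff (Abs_shift_series d) = d"
    by (simp add: Abs_shift_series_inverse)
  then show "has_op_derivative X (Abs_shift_series d) t"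
    using assms(1) by (simp add: has_op_derivative_def d_def vector_derivative_works)
qed

text \<open>Differentiate \<open>Y s * X s = 1\<close> and multiply by \<open>Y t\<close> from the
  right.\<close>

lemma has_op_derivative_inverse:
  assumes X: "has_op_derivative X D t" and Y: "has_op_derivative Y E t"
    and N: "\<And>s. \<forall>k>N. \<forall>n. coeff (X s) k n = 0"
    and M: "\<And>s. \<forall>k>M. \<forall>n. coeff (Y s) k n = 0"
    and inv: "\<And>s. X s * Y s = 1" "\<And>s. Y s * X s = 1"
  shows "E = - (Y t * D * Y t)"
proof -
  have "has_op_derivative (\<lambda>s. 1) (E * X t + Y t * D) t"
    using has_op_derivative_times[OF Y X M N] by (simp add: inv)
  then have "E * X t + Y t * D = 0"
    using has_op_derivative_const has_op_derivative_unique by blast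
  then have "E * X t = - (Y t * D)"
    by (simp add: eq_neg_iff_add_eq_0)
  then have "E * X t * Y t = - (Y t * D) * Y t" by simp
  then show ?thesis by (simp add: mult.assoc inv)
qed

lemma differentiable_prod_real_normed_field:
  fixes g :: "'i \<Rightarrow> real \<Rightarrow> 'a::real_normed_field"
  assumes "\<And>i. i \<in> S \<Longrightarrow> g i differentiable (at t)"
  shows "(\<lambda>s. \<Prod>i\<in>S. g i s) differentiable (at t)"
  using assms by (induction S rule: infinite_finite_induct) auto

lemma lax_Q_inv_bounded:
  "0 < m \<Longrightarrow> \<forall>k>0. \<forall>n. coeff (lax_Q_inv m v) k n = 0"
  by (simp add: coeff_lax_Q_inv)

lemma lax_Q_inv_differentiable:
  fixes u :: "int \<Rightarrow> real \<Rightarrow> 'a::real_normed_field"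
  assumes "0 < m" and "\<And>n. u n differentiable (at t)"
  shows "(\<lambda>s. coeff (lax_Q_inv m (\<lambda>n. u n s)) k n) differentiable (at t)"
  using assms
  by (cases "m dvd k \<and> k < 0")
     (auto simp: coeff_lax_Q_inv intro!: differentiable_prod_real_normed_field)

text \<open>The argument is purely algebraic in \<open>A\<close> and \<open>B\<close>, which stay
  arbitrary; differentiability of \<open>u\<close> serves to differentiate the inverse of
  \<open>Q\<close>.\<close>

lemma lax_equation:
  fixes u :: "int \<Rightarrow> real \<Rightarrow> 'a::real_normed_field"
  assumes "0 < m"
    and u: "\<And>n. u n differentiable (at t)"
    and P: "has_op_derivative (lax_P m l u) (B * lax_P m l u t - lax_P m l u t * A) t"
    and Q: "has_op_derivative (lax_Q m u) (B * lax_Q m u t - lax_Q m u t * A) t"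
  shows "has_op_derivative (lax_L m l u) (A * lax_L m l u t - lax_L m l u t * A) t"
proof -
  \<comment> \<open>The explicit inverse replaces \<open>series_inverse\<close>, whose description
    gives no access to coefficients.\<close>
  define R where "R s = lax_Q_inv m (\<lambda>n. u n s)" for s
  have inv: "lax_Q m u s * R s = 1" "R s * lax_Q m u s = 1" for s
    using lax_Q_times_inv[OF \<open>0 < m\<close>] by (simp_all add: R_def)
  have L: "lax_L m l u s = R s * lax_P m l u s" for s
    by (simp add: lax_L_def series_inverse_eqI[OF inv])
  have bP: "\<forall>k>m + l. \<forall>n. coeff (lax_P m l u s) k n = 0" for s
    using \<open>0 < m\<close> by (simp add: coeff_lax_P)
  have bQ: "\<forall>k>m. \<forall>n. coeff (lax_Q m u s) k n = 0" for s
    using \<open>0 < m\<close> by (simp add: coeff_lax_Q)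
  have bR: "\<forall>k>0. \<forall>n. coeff (R s) k n = 0" for s
    unfolding R_def using lax_Q_inv_bounded \<open>0 < m\<close> .
  obtain E where E: "has_op_derivative R E t"
  proof (rule has_op_derivative_exists)
    show "(\<lambda>s. coeff (R s) k n) differentiable (at t)" for k n
      unfolding R_def by (rule lax_Q_inv_differentiable[OF \<open>0 < m\<close> u])
  qed (rule bR)
  \<comment> \<open>Cancels inside right-bracketed products, where \<open>inv\<close> alone does not
    match.\<close>
  have inv_left: "R t * (lax_Q m u t * Z) = Z" for Z
    using inv by (simp flip: mult.assoc)
  have "E = - (R t * (B * lax_Q m u t - lax_Q m u t * A) * R t)"
    by (rule has_op_derivative_inverse[OF Q E bQ bR inv])
  also have "\<dots> = A * R t - R t * B"
    by (simp add: left_diff_distrib right_diff_distrib mult.assoc inv inv_left)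
  finally have E_eq: "E = A * R t - R t * B" .
  \<comment> \<open>The term \<open>R t * B * lax_P m l u t\<close> occurs with both signs.\<close>
  have "E * lax_P m l u t + R t * (B * lax_P m l u t - lax_P m l u t * A)
      = A * lax_L m l u t - lax_L m l u t * A"
    by (simp add: E_eq L left_diff_distrib right_diff_distrib mult.assoc)
  then show ?thesis
    using has_op_derivative_times[OF E P bR bP] by (simp add: L[abs_def])
qed

lemma lax_pair_iff:
  fixes u f :: "int \<Rightarrow> real \<Rightarrow> 'a::real_normed_field"
  assumes "0 < m" "0 < l"
  shows "has_op_derivative (lax_P m l u)
        (lax_B m l u f t * lax_P m l u t - lax_P m l u t * lax_A m f t) t \<and>
      has_op_derivative (lax_Q m u)
        (lax_B m l u f t * lax_Q m u t - lax_Q m u t * lax_A m f t) t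
    \<longleftrightarrow> (\<forall>n. u (n + m) t * f (n + m) t = u n t * f (n + m + l) t \<and>
      ((\<lambda>s. u n s) has_vector_derivative
        (u n t)\<^sup>2 * (f n t - f (n + m + l) t) + f (n + m) t - f (n + l) t) (at t))"
    (is "?P \<and> ?Q \<longleftrightarrow> (\<forall>n. ?constraint n \<and> ?evolution n)")
proof
  assume PQ: "?P \<and> ?Q"
  show "\<forall>n. ?constraint n \<and> ?evolution n"
  proof
    fix n
    \<comment> \<open>The power \<open>2 * m + l\<close> exceeds the order \<open>m + l\<close> of
      \<open>P\<close>, so its coefficient in \<open>P\<close> is constantly 0.\<close>
    have "((\<lambda>s. 0) has_vector_derivative u (n + m) t * f (n + m) t - u n t * f (n + m + l) t) (at t)"
      using PQ[THEN conjunct1, unfolded has_op_derivative_def, rule_format, of "2 * m + l" n] assms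
      \<comment> \<open>Without \<open>coeff_minus\<close> the difference stays whole and
        \<open>coeff_lax_P_rhs\<close> can match it.\<close>
      by (simp add: coeff_lax_P coeff_lax_P_rhs del: coeff_minus)
    then have "?constraint n"
      using has_vector_derivative_const vector_derivative_unique_at by fastforce
    moreover have "?evolution n"
      using PQ[THEN conjunct2, unfolded has_op_derivative_def, rule_format, of 0 n] assms
      by (simp add: coeff_lax_Q coeff_lax_Q_rhs del: coeff_minus)
    ultimately show "?constraint n \<and> ?evolution n" ..
  qed
next
  assume *: "\<forall>n. ?constraint n \<and> ?evolution n"
  \<comment> \<open>The form in which the constraint appears at \<open>T^l\<close> in the first
    identity and at \<open>T^(- m)\<close> in the second.\<close>
  have c: "u n t * f n t = u (n - m) t * f (n + l) t" for n
    using *[rule_format, of "n - m"] by simp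
  have "?P" "?Q"
    unfolding has_op_derivative_def
    using * c assms
    by (auto simp: coeff_lax_P coeff_lax_Q coeff_lax_P_rhs coeff_lax_Q_rhs
        simp del: coeff_minus)
  then show "?P \<and> ?Q" ..
qed

theorem theorem2:
  fixes m l :: int
    and u f :: "int \<Rightarrow> real \<Rightarrow> 'a::real_normed_field"
    and I :: "real set"
  assumes "0 < m" and "0 < l" and "coprime m l" and "open I"
  shows
    "((\<forall>t\<in>I.
         has_op_derivative (lax_P m l u)
           (lax_B m l u f t * lax_P m l u t - lax_P m l u t * lax_A m f t) t \<and>
         has_op_derivative (lax_Q m u)
           (lax_B m l u f t * lax_Q m u t - lax_Q m u t * lax_A m f t) t)
      \<longleftrightarrow>
      (\<forall>t\<in>I. \<forall>n.
         u (n + m) t * f (n + m) t = u n t * f (n + m + l) t \<and>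
         ((\<lambda>s. u n s) has_vector_derivative
           (u n t)\<^sup>2 * (f n t - f (n + m + l) t) + f (n + m) t - f (n + l) t) (at t)))
     \<and>
     ((\<forall>t\<in>I. \<forall>n.
         u (n + m) t * f (n + m) t = u n t * f (n + m + l) t \<and>
         ((\<lambda>s. u n s) has_vector_derivative
           (u n t)\<^sup>2 * (f n t - f (n + m + l) t) + f (n + m) t - f (n + l) t) (at t))
      \<longrightarrow>
      (\<forall>t\<in>I.
         has_op_derivative (lax_L m l u)
           (lax_A m f t * lax_L m l u t - lax_L m l u t * lax_A m f t) t))"
proof -
  note iff = lax_pair_iff[OF \<open>0 < m\<close> \<open>0 < l\<close>, of u f]
  have "has_op_derivative (lax_L m l u)
      (lax_A m f t * lax_L m l u t - lax_L m l u t * lax_A m f t) t"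
    if sys: "\<forall>n. u (n + m) t * f (n + m) t = u n t * f (n + m + l) t \<and>
      ((\<lambda>s. u n s) has_vector_derivative
        (u n t)\<^sup>2 * (f n t - f (n + m + l) t) + f (n + m) t - f (n + l) t) (at t)" for t
  proof -
    \<comment> \<open>The evolution equation itself supplies the differentiability.\<close>
    have "u n differentiable (at t)" for n
      using sys by (auto intro: differentiableI_vector)
    then show ?thesis
      using iff[THEN iffD2, OF sys] lax_equation[OF \<open>0 < m\<close>] by blast
  qed
  then show ?thesis using iff by simp
qed

end
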